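(* Let $T$ be a tree of order $n \ge 2$. Then $\mathrm{cdim}(T)=\dim(T)$ if and only if $T=P_n$.
   Context: $P_n$ is the path on $n$ vertices; equality of graphs means isomorphism. A set $S\subseteq V(G)$ is a resolving set of a connected graph $G$ if for every pair of distinct vertices $x,y$ of $G$ there is $z\in S$ with $d(x,z)\ne d(y,z)$ ($d$ is the shortest-path distance); it is a connected resolving set if moreover the induced subgraph $G[S]$ is connected. $\dim(G)$ is the minimum cardinality of a resolving set of $G$, and $\mathrm{cdim}(G)$ is the minimum cardinality of a connected resolving set of $G$. Graphs are finite, simple, undirected. *)

theory Defs
  imports "Graph_Theory.Graph_Theory"
begin

text \<open>
  A finite simple undirected graph is the \<^locale>\<open>graph\<close> of Graph_Theory: a finite symmetric
  digraph without loops or parallel arcs, an edge uv being the two arcs (u,v) and (v,u).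
\<close>

text \<open>
  Traversing an edge back and forth is a \<^term>\<open>pre_digraph.cycle\<close> of length 2 in a symmetric
  digraph, so the library's \<^const>\<open>tree\<close> does not describe undirected trees. The cycles of
  the undirected graph are exactly those of length at least 3.
\<close>
definition undirected_tree :: "('a, 'b) pre_digraph \<Rightarrow> bool" where
  "undirected_tree G \<longleftrightarrow> graph G \<and> connected G \<and>
     \<not> (\<exists>p. pre_digraph.cycle G p \<and> 3 \<le> length p)"

definition graph_dist :: "('a, 'b) pre_digraph \<Rightarrow> 'a \<Rightarrow> 'a \<Rightarrow> ereal" where
  "graph_dist G u v = wf_digraph.\<mu> G (\<lambda>_. 1) u v"

definition resolving_set :: "('a, 'b) pre_digraph \<Rightarrow> 'a set \<Rightarrow> bool" where
  "resolving_set G S \<longleftrightarrow> S \<subseteq> verts G \<and>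
     (\<forall>x\<in>verts G. \<forall>y\<in>verts G. x \<noteq> y \<longrightarrow> (\<exists>z\<in>S. graph_dist G x z \<noteq> graph_dist G y z))"

text \<open>
  \<^const>\<open>connected\<close> requires a nonempty vertex set. This matters only for graphs of order at
  most 1, since otherwise a resolving set is nonempty.
\<close>
definition connected_resolving_set :: "('a, 'b) pre_digraph \<Rightarrow> 'a set \<Rightarrow> bool" where
  "connected_resolving_set G S \<longleftrightarrow> resolving_set G S \<and> connected (G \<restriction> S)"

definition metric_dim :: "('a, 'b) pre_digraph \<Rightarrow> nat" where
  "metric_dim G = (LEAST k. \<exists>S. resolving_set G S \<and> card S = k)"

definition connected_metric_dim :: "('a, 'b) pre_digraph \<Rightarrow> nat" where
  "connected_metric_dim G = (LEAST k. \<exists>S. connected_resolving_set G S \<and> card S = k)"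

definition path_graph :: "nat \<Rightarrow> nat pair_pre_digraph" where
  "path_graph n = \<lparr> pverts = {..<n},
     parcs = {(i, j). i < n \<and> j < n \<and> (j = Suc i \<or> i = Suc j)} \<rparr>"

end

theory Submission
  imports Defs
begin

text \<open>
  In a tree the distances from any vertex \<open>x\<close> to two neighbours \<open>a\<close>, \<open>b\<close> of a vertex \<open>s\<close>
  determine its distance to \<open>s\<close>: both differ from it by exactly one, and at most one neighbour
  of \<open>s\<close> is nearer to \<open>x\<close> than \<open>s\<close> is, so that \<open>d x s + 1 = max (d x a) (d x b)\<close>
  (\<open>Suc_hop_dist_eq_max\<close>). Hence a vertex with two neighbours inside a resolving set can be
  dropped from it (\<open>resolving_set_remove_inner\<close>).

  If \<open>cdim(T) = dim(T)\<close>, a minimum connected resolving set \<open>S\<close> is also a minimum resolving set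
  and so contains no droppable vertex. A connected set in which nobody has two neighbours is a
  single vertex or the two ends of an edge. In both cases resolving means that \<open>T\<close> can be
  laid out along a line: by the distance to the single vertex, or, for an edge \<open>ab\<close>, by
  the distance to \<open>a\<close> towards the left on the side of \<open>a\<close> and by the distance to \<open>b\<close> towards the
  right on the side of \<open>b\<close>. Each position is occupied at most once and edges span at most one
  step, which forces a path (\<open>path_if_injective_slow_labelling\<close>).

  Conversely an endpoint of a path resolves it, and a single vertex is connected. So both
  dimensions of a path of order at least 2 are 1, since the empty set does not resolve it.
\<close>

section \<open>Distances in connected graphs\<close>

text \<open>
  \<^const>\<open>graph_dist\<close> is an infimum in the extended reals. A least exponent of the adjacency
  relation is the same number as a natural, ready for induction and linear arithmetic.
\<close>

definition (in pre_digraph) hop_dist :: "'a \<Rightarrow> 'a \<Rightarrow> nat" where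
  "hop_dist u v = (LEAST k. (u, v) \<in> arcs_ends G ^^ k)"

locale connected_graph = graph +
  assumes connected_G: "connected G"

lemma (in wf_digraph) relpow_if_awalk:
  "awalk u p v \<Longrightarrow> (u, v) \<in> arcs_ends G ^^ length p"
proof (induction p arbitrary: u)
  case Nil
  then show ?case by (simp add: awalk_Nil_iff)
next
  case (Cons e p)
  then have "(u, head G e) \<in> arcs_ends G" "(head G e, v) \<in> arcs_ends G ^^ length p"
    by (auto simp: awalk_Cons_iff intro: in_arcs_imp_in_arcs_ends)
  then show ?case
    unfolding length_Cons by (rule relpow_Suc_I2)
qed

lemma (in wf_digraph) awalk_if_relpow:
  "(u, v) \<in> arcs_ends G ^^ k \<Longrightarrow> u \<in> verts G \<Longrightarrow> \<exists>p. awalk u p v \<and> length p = k"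
proof (induction k arbitrary: u)
  case 0
  then show ?case by (auto simp: awalk_Nil_iff)
next
  case (Suc k)
  then obtain w where w: "(u, w) \<in> arcs_ends G" "(w, v) \<in> arcs_ends G ^^ k"
    by (meson relpow_Suc_D2)
  from w(1) obtain e where e: "e \<in> arcs G" "tail G e = u" "head G e = w" by (rule reachableE)
  obtain p where "awalk w p v" "length p = k"
    using Suc.IH[OF w(2)] adj_in_verts(2)[OF w(1)] by blast
  with e have "awalk u (e # p) v" "length (e # p) = Suc k" by (auto simp: awalk_Cons_iff)
  then show ?case by blast
qed

context connected_graph
begin

abbreviation d :: "'a \<Rightarrow> 'a \<Rightarrow> nat" where "d \<equiv> hop_dist"

lemma adj_sym: "u \<rightarrow> v \<Longrightarrow> v \<rightarrow> u"
  using arcs_ends_symmetric[OF sym_arcs] .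

lemma all_reachable:
  assumes "u \<in> verts G" "v \<in> verts G" shows "u \<rightarrow>\<^sup>* v"
  using symmetric_connected_imp_strongly_connected[OF sym_arcs connected_G] assms by auto

lemma hop_dist_le: "(u, v) \<in> arcs_ends G ^^ k \<Longrightarrow> d u v \<le> k"
  unfolding hop_dist_def by (rule Least_le)

lemma hop_dist_attained:
  assumes "u \<in> verts G" "v \<in> verts G" shows "(u, v) \<in> arcs_ends G ^^ d u v"
proof -
  have "(u, v) \<in> (arcs_ends G)\<^sup>*"
    using all_reachable[OF assms] by (rule reachable_rtranclI)
  then obtain k where "(u, v) \<in> arcs_ends G ^^ k" by (auto simp: rtrancl_power)
  then show ?thesis unfolding hop_dist_def by (rule LeastI)
qed

lemma graph_dist_eq_hop_dist:
  assumes "u \<in> verts G" "v \<in> verts G"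
  shows "graph_dist G u v = ereal (real (d u v))"
proof -
  have cost: "awalk_cost (\<lambda>_. 1) p = real (length p)" for p
    by (induction p) auto
  obtain p where p: "awalk u p v" "length p = d u v"
    using awalk_if_relpow[OF hop_dist_attained[OF assms] assms(1)] by blast
  show ?thesis
    unfolding graph_dist_def \<mu>_def
  proof (rule INF_eqI)
    fix q assume "q \<in> {q. awalk u q v}"
    then show "ereal (real (d u v)) \<le> ereal (awalk_cost (\<lambda>_. 1) q)"
      using hop_dist_le[OF relpow_if_awalk] by (simp add: cost)
  next
    fix y assume "\<And>q. q \<in> {q. awalk u q v} \<Longrightarrow> y \<le> ereal (awalk_cost (\<lambda>_. 1) q)"
    from this[of p] show "y \<le> ereal (real (d u v))" using p by (simp add: cost)
  qed
qed

lemma hop_dist_commute: "d u v = d v u"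
proof -
  have flip: "(b, a) \<in> arcs_ends G ^^ k" if "(a, b) \<in> arcs_ends G ^^ k" for a b k
    using that
  proof (induction k arbitrary: b)
    case (Suc k)
    then obtain c where "(a, c) \<in> arcs_ends G ^^ k" "c \<rightarrow> b" by auto
    then show ?case using Suc.IH adj_sym by (blast intro: relpow_Suc_I2)
  qed simp
  show ?thesis unfolding hop_dist_def by (rule arg_cong[where f = Least]) (use flip in blast)
qed

lemma hop_dist_self[simp]: "d u u = 0"
  using hop_dist_le[of u u 0] by simp

lemma hop_dist_eq_0_iff:
  assumes "u \<in> verts G" "v \<in> verts G" shows "d u v = 0 \<longleftrightarrow> u = v"
  using hop_dist_attained[OF assms] by auto

lemma hop_dist_adj_le:
  assumes "x \<in> verts G" "u \<rightarrow> v" shows "d x v \<le> Suc (d x u)"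
  using hop_dist_attained[OF assms(1) adj_in_verts(1)[OF assms(2)]] assms(2)
  by (intro hop_dist_le) auto

lemma closer_neighbour:
  assumes "x \<in> verts G" "v \<in> verts G" "d x v = Suc k"
  obtains w where "v \<rightarrow> w" "d x w = k"
proof -
  obtain w where w: "(x, w) \<in> arcs_ends G ^^ k" "w \<rightarrow> v"
    using hop_dist_attained[OF assms(1,2)] assms(3) by auto
  have "d x w = k"
    using hop_dist_le[OF w(1)] hop_dist_adj_le[OF assms(1) w(2)] assms(3) by simp
  then show ?thesis using that adj_sym[OF w(2)] by blast
qed

text \<open>
  Here the landmark \<open>z\<close> comes first, so that \<open>d z\<close> is a coordinate function on the vertices.
\<close>
lemma resolving_set_iff:
  "resolving_set G S \<longleftrightarrow> S \<subseteq> verts G \<and>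
    (\<forall>x\<in>verts G. \<forall>y\<in>verts G. (\<forall>z\<in>S. d z x = d z y) \<longrightarrow> x = y)"
proof (cases "S \<subseteq> verts G")
  case True
  then have "graph_dist G x z = graph_dist G y z \<longleftrightarrow> d z x = d z y"
    if "x \<in> verts G" "y \<in> verts G" "z \<in> S" for x y z
    using that by (auto simp: graph_dist_eq_hop_dist subset_iff hop_dist_commute[of z])
  then show ?thesis unfolding resolving_set_def by blast
qed (simp add: resolving_set_def)

text \<open>
  The minimum in the definition of either dimension is therefore taken over a nonempty family.
\<close>
lemma connected_resolving_set_verts: "connected_resolving_set G (verts G)"
proof -
  have "G \<restriction> verts G = G"
    by (auto simp: induce_subgraph_def intro!: pre_digraph.equality)
  moreover have "x = y" if "x \<in> verts G" "y \<in> verts G" "\<forall>z\<in>verts G. d z x = d z y" for x y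
    using bspec[OF that(3,1)] hop_dist_eq_0_iff[OF that(1,2)] by simp
  then have "resolving_set G (verts G)" unfolding resolving_set_iff by simp
  ultimately show ?thesis by (simp add: connected_resolving_set_def connected_G)
qed

section \<open>Recognising a path\<close>

text \<open>
  Since labels change by at most one along edges and the graph is connected, a discrete
  intermediate value argument shows that the labels fill an interval, and it also shows that
  consecutive labels belong to adjacent vertices. Shifting the interval to start at 0 gives the
  isomorphism.
\<close>
lemma path_if_injective_slow_labelling:
  fixes g :: "'a \<Rightarrow> int"
  assumes inj: "inj_on g (verts G)"
    and slow: "\<And>u v. u \<rightarrow> v \<Longrightarrow> g v \<le> g u + 1"
  shows "digraph_iso G (with_proj (path_graph (card (verts G))))"
proof -
  define n m M where "n = card (verts G)" and "m = Min (g ` verts G)" and "M = Max (g ` verts G)"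
  have "verts G \<noteq> {}" using connected_G by (auto simp: connected_def strongly_connected_def)
  then have mM: "m \<in> g ` verts G" "M \<in> g ` verts G" by (auto simp: m_def M_def)
  have between: "t \<in> g ` verts G" if "u \<rightarrow>\<^sup>* v" "g u \<le> t" "t \<le> g v" for u v t
    using that
  proof (induction rule: reachable_induct)
    case base
    then show ?case by force
  next
    case (step x y)
    then show ?case
      using slow[OF step.hyps(2)] adj_in_verts(2)[OF step.hyps(2)]
      by (cases "t = g y") auto
  qed
  have img: "g ` verts G = {m..M}"
  proof
    show "{m..M} \<subseteq> g ` verts G" using mM between[OF all_reachable] by auto
    show "g ` verts G \<subseteq> {m..M}" by (auto simp: m_def M_def)
  qed
  have n: "n = nat (M - m + 1)"
    using card_image[OF inj] img unfolding n_def by simp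
  \<comment> \<open>Walking from \<open>u\<close> to \<open>v\<close> some edge leaves the set of labels \<open>\<le> g u\<close>; as labels are
    distinct and edges change them by at most one, that edge can only be \<open>uv\<close>.\<close>
  have consec: "u \<rightarrow> v" if uv: "u \<in> verts G" "v \<in> verts G" "g v = g u + 1" for u v
  proof -
    have "g w \<le> g u \<or> (\<exists>x y. x \<rightarrow> y \<and> g x \<le> g u \<and> g u < g y)" if "u \<rightarrow>\<^sup>* w" for w
      using that
    proof (induction rule: reachable_induct)
      case (step x y)
      then show ?case by (cases "g y \<le> g u") (auto simp: not_le)
    qed simp
    from this[OF all_reachable[OF uv(1,2)]] uv(3)
    obtain x y where xy: "x \<rightarrow> y" "g x \<le> g u" "g u < g y" by auto
    then have "g x = g u" "g y = g v" using slow[OF xy(1)] uv(3) by linarith+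
    then have "x = u" "y = v"
      using inj_onD[OF inj] uv(1,2) adj_in_verts[OF xy(1)] by blast+
    then show ?thesis using xy(1) by simp
  qed
  define f where "f v = nat (g v - m)" for v
  have ge: "m \<le> g v" "g v \<le> M" if "v \<in> verts G" for v using img that by auto
  have inj_f: "inj_on f (verts G)"
  proof (rule inj_onI)
    fix u v assume uv: "u \<in> verts G" "v \<in> verts G" "f u = f v"
    then have "g u = g v" using ge(1)[OF uv(1)] ge(1)[OF uv(2)] by (simp add: f_def)
    then show "u = v" using inj_onD[OF inj] uv(1,2) by blast
  qed
  have img_f: "f ` verts G = {..<n}"
  proof
    show "f ` verts G \<subseteq> {..<n}" using ge by (force simp: f_def n)
    show "{..<n} \<subseteq> f ` verts G"
    proof
      fix i assume "i \<in> {..<n}"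
      then have "m + int i \<in> {m..M}" by (auto simp: n)
      then obtain v where "v \<in> verts G" "g v = m + int i" unfolding img[symmetric] by force
      then show "i \<in> f ` verts G" by (force simp: f_def)
    qed
  qed
  have adj_f: "u \<rightarrow> v \<longleftrightarrow> f v = Suc (f u) \<or> f u = Suc (f v)"
    if uv: "u \<in> verts G" "v \<in> verts G" for u v
  proof
    assume "u \<rightarrow> v"
    moreover have "g u \<noteq> g v" using \<open>u \<rightarrow> v\<close> inj_onD[OF inj _ uv] adj_not_same by blast
    ultimately have "g v = g u + 1 \<or> g u = g v + 1"
      using slow[of u v] slow[of v u] adj_sym by force
    then show "f v = Suc (f u) \<or> f u = Suc (f v)"
      using ge(1)[OF uv(1)] ge(1)[OF uv(2)] unfolding f_def by linarith
  next
    assume "f v = Suc (f u) \<or> f u = Suc (f v)"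
    then have "g v = g u + 1 \<or> g u = g v + 1" using ge[OF uv(1)] ge[OF uv(2)] by (auto simp: f_def)
    then show "u \<rightarrow> v" using consec uv adj_sym by blast
  qed
  define h where "h = \<lparr>iso_verts = f, iso_arcs = (\<lambda>e. (f (tail G e), f (head G e))),
    iso_head = snd, iso_tail = fst\<rparr>"
  have "digraph_isomorphism h"
    unfolding digraph_isomorphism_def
  proof (intro conjI)
    show "inj_on (iso_arcs h) (arcs G)"
    proof (rule inj_onI)
      fix e e' assume e: "e \<in> arcs G" "e' \<in> arcs G" "iso_arcs h e = iso_arcs h e'"
      then have "tail G e = tail G e'" "head G e = head G e'"
        using inj_onD[OF inj_f] by (auto simp: h_def)
      then show "e = e'" using e no_multi_arcs by (simp add: arc_to_ends_def)
    qed
  qed (use inj_f in \<open>auto simp: h_def intro: wf_digraph\<close>)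
  moreover have "with_proj (path_graph n) = app_iso h G"
  proof -
    have "iso_arcs h ` arcs G = (\<lambda>(u, v). (f u, f v)) ` arcs_ends G"
      by (auto simp: h_def arcs_ends_conv image_image)
    also have "\<dots> = parcs (path_graph n)"
    proof (intro set_eqI iffI)
      fix e assume "e \<in> (\<lambda>(u, v). (f u, f v)) ` arcs_ends G"
      then obtain u v where uv: "u \<rightarrow> v" "e = (f u, f v)" by auto
      then have "u \<in> verts G" "v \<in> verts G" using adj_in_verts by auto
      then show "e \<in> parcs (path_graph n)" using uv adj_f img_f by (auto simp: path_graph_def)
    next
      fix e assume "e \<in> parcs (path_graph n)"
      then obtain i j where ij: "e = (i, j)" "i \<in> f ` verts G" "j \<in> f ` verts G"
        "j = Suc i \<or> i = Suc j"
        unfolding img_f by (auto simp: path_graph_def)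
      then obtain u v where "u \<in> verts G" "v \<in> verts G" "i = f u" "j = f v" by auto
      then show "e \<in> (\<lambda>(u, v). (f u, f v)) ` arcs_ends G"
        using ij(1,4) adj_f by force
    qed
    finally show ?thesis
      by (intro pre_digraph.equality) (auto simp: h_def img_f path_graph_def)
  qed
  ultimately show ?thesis unfolding digraph_iso_def n_def by blast
qed

text \<open>
  Distances from the vertex carried to 0 are the labels given by the isomorphism: a walk changes
  the label by at most one in each step, and walking straight along the path attains this bound.
  As the labels are distinct, this vertex resolves the graph.
\<close>
lemma path_endpoint_resolves:
  assumes iso: "digraph_iso G (with_proj (path_graph n))" and n: "n \<ge> 2"
  obtains z where "connected_resolving_set G {z}"
proof -
  obtain h where h: "digraph_isomorphism h" "with_proj (path_graph n) = app_iso h G"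
    using iso unfolding digraph_iso_def by blast
  define f where "f = iso_verts h"
  have inj: "inj_on f (verts G)" using h(1) by (simp add: f_def digraph_isomorphism_inj_on_verts)
  have img: "f ` verts G = {..<n}"
    using arg_cong[OF h(2), of verts] by (simp add: f_def path_graph_def)
  have "tail (app_iso h G) = fst" "head (app_iso h G) = snd" using h(2)[symmetric] by simp_all
  then have "iso_tail h = fst" "iso_head h = snd" by simp_all
  then have iso_arc: "iso_arcs h e = (f (tail G e), f (head G e))" if "e \<in> arcs G" for e
    using iso_verts_tail[OF h(1) that] iso_verts_head[OF h(1) that] by (simp add: f_def prod_eq_iff)
  have arcs: "iso_arcs h ` arcs G = parcs (path_graph n)"
    using arg_cong[OF h(2), of arcs] by simp
  obtain z where z: "z \<in> verts G" "f z = 0"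
    using img n by (metis imageE lessThan_iff less_le_trans zero_less_numeral)
  have dist: "d z v = f v" if "v \<in> verts G" for v
  proof (rule antisym)
    have "f w \<le> k" if "(z, w) \<in> arcs_ends G ^^ k" for k w
      using that
    proof (induction k arbitrary: w)
      case (Suc k)
      then obtain x where x: "(z, x) \<in> arcs_ends G ^^ k" "x \<rightarrow> w" by auto
      from x(2) obtain e where e: "e \<in> arcs G" "tail G e = x" "head G e = w" by (rule reachableE)
      then have "(f x, f w) \<in> parcs (path_graph n)" using arcs iso_arc by force
      then have "f w \<le> Suc (f x)" by (auto simp: path_graph_def)
      then show ?case using Suc.IH[OF x(1)] by simp
    qed (use z in simp)
    then show "f v \<le> d z v" using hop_dist_attained[OF z(1) that] by blast
  next
    have "d z v \<le> k" if "v \<in> verts G" "f v = k" for v k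
      using that
    proof (induction k arbitrary: v)
      case 0
      then have "v = z" using inj_onD[OF inj, of v z] z by simp
      then show ?case by simp
    next
      case (Suc k)
      then have "f v \<in> {..<n}" using img by blast
      then have "k < n" "Suc k < n" using Suc.prems by auto
      then have "(k, Suc k) \<in> parcs (path_graph n)" by (simp add: path_graph_def)
      then obtain e where e: "e \<in> arcs G" "f (tail G e) = k" "f (head G e) = Suc k"
        using arcs iso_arc by (metis (no_types, lifting) imageE prod.inject)
      then have "head G e = v" using inj_onD[OF inj, of "head G e" v] Suc.prems by simp
      then have "tail G e \<rightarrow> v" using e(1) in_arcs_imp_in_arcs_ends by blast
      from hop_dist_adj_le[OF z(1) this] show ?case
        using Suc.IH[of "tail G e"] e by simp
    qed
    then show "d z v \<le> f v" using that by blast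
  qed
  have "resolving_set G {z}"
    unfolding resolving_set_iff using z(1) inj_onD[OF inj] dist by simp
  moreover have "connected (G \<restriction> {z})"
    by (auto simp: connected_def strongly_connected_def reachable_def)
  ultimately show ?thesis using that by (simp add: connected_resolving_set_def)
qed

end

section \<open>Distances in trees\<close>

text \<open>
  A walk to and fro along an edge is a \<open>cycle\<close> of length 2, so only longer
  cycles are excluded.
\<close>
locale finite_tree = connected_graph +
  assumes acyclic: "cycle p \<Longrightarrow> length p < 3"
begin

text \<open>
  Otherwise a path from \<open>a\<close> to \<open>b\<close> avoiding \<open>s\<close> would close up through \<open>s\<close> to a cycle of length
  at least 3.
\<close>
lemma neighbours_separated:
  assumes adj: "s \<rightarrow> a" "s \<rightarrow> b" and "a \<rightarrow>\<^sup>*\<^bsub>del_vert s\<^esub> b"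
  shows "a = b"
proof (rule ccontr)
  assume "a \<noteq> b"
  interpret D: wf_digraph "del_vert s" by (rule wf_digraph_del_vert)
  obtain p where p: "D.apath a p b" using assms(3) D.reachable_apath by blast
  have "s \<notin> set (D.awalk_verts a p)"
    using p by (auto simp: D.apath_def verts_del_vert elim!: D.awalkE)
  then have s: "s \<notin> set (awalk_verts a p)"
    using subgraph_del_vert[of s] by (auto simp: subgraph_def dest: compatible_awalk_verts)
  have ap: "apath a p b" using p subgraph_del_vert by (rule subgraph_apath_imp_apath)
  from adj(1) obtain e where e: "e \<in> arcs G" "tail G e = s" "head G e = a" by (rule reachableE)
  from adj_sym[OF adj(2)] obtain e' where e': "e' \<in> arcs G" "tail G e' = b" "head G e' = s"
    by (rule reachableE)
  have aw: "awalk a p b" using ap by (simp add: apath_def)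
  then have w: "awalk a (p @ [e']) s"
    using e' by (auto simp: awalk_simps)
  have "awlast a p = b" using aw by blast
  then have "awalk_verts a (p @ [e']) = awalk_verts a p @ [s]"
    using awalk_verts_append[OF w] e' by simp
  then have "distinct (awalk_verts a (p @ [e']))" using ap s by (simp add: apath_def)
  moreover have "awalk s (e # p @ [e']) s"
    using e w by (simp add: awalk_Cons_iff del: awalk_append_iff)
  ultimately have "cycle (e # p @ [e'])" unfolding cycle_def using e by auto
  moreover have "p \<noteq> []" using aw \<open>a \<noteq> b\<close> by (auto simp: awalk_Nil_iff)
  ultimately show False using acyclic[of "e # p @ [e']"] by (cases p) auto
qed

text \<open>
  After \<open>a\<close> itself, a shortest path from \<open>a\<close> to \<open>x\<close> only visits vertices strictly nearer to
  \<open>x\<close> than \<open>s\<close> is.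
\<close>
lemma reaches_root_avoiding:
  assumes "x \<in> verts G" "a \<in> verts G" "a \<noteq> s" "d x a \<le> d x s"
  shows "a \<rightarrow>\<^sup>*\<^bsub>del_vert s\<^esub> x"
  using assms(2-4)
proof (induction "d x a" arbitrary: a)
  case 0
  interpret D: wf_digraph "del_vert s" by (rule wf_digraph_del_vert)
  have "a = x" using 0 hop_dist_eq_0_iff[OF assms(1)] by metis
  then show ?case using 0 by (auto simp: verts_del_vert)
next
  case (Suc k)
  interpret D: wf_digraph "del_vert s" by (rule wf_digraph_del_vert)
  obtain b where b: "a \<rightarrow> b" "d x b = k" using closer_neighbour[OF assms(1) Suc.prems(1)] Suc.hyps(2) by metis
  then have "b \<noteq> s" using Suc by auto
  then have "b \<rightarrow>\<^sup>*\<^bsub>del_vert s\<^esub> x"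
    using Suc.hyps b Suc.prems adj_in_verts(2)[OF b(1)] by auto
  moreover have "a \<rightarrow>\<^bsub>del_vert s\<^esub> b"
    using b(1) Suc.prems(2) \<open>b \<noteq> s\<close> by (auto simp: arcs_ends_conv del_vert_simps)
  ultimately show ?case by (rule D.adj_reachable_trans[rotated])
qed

text \<open>
  Both neighbours reach \<open>x\<close>, hence each other, without passing through \<open>s\<close>. Admitting equal
  distances in the hypotheses makes this one lemma yield both the uniqueness of the parent of
  \<open>s\<close> in the tree rooted at \<open>x\<close> and the absence of edges within a level.
\<close>
lemma at_most_one_parent:
  assumes "x \<in> verts G" "s \<rightarrow> a" "s \<rightarrow> b" "d x a \<le> d x s" "d x b \<le> d x s"
  shows "a = b"
proof -
  interpret D: wf_digraph "del_vert s" by (rule wf_digraph_del_vert)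
  have sym: "symmetric (del_vert s)"
    using sym_arcs unfolding symmetric_conv by (fastforce simp: del_vert_simps)
  have ne: "a \<noteq> s" "b \<noteq> s" using assms(2,3) adj_not_same by auto
  have "a \<rightarrow>\<^sup>*\<^bsub>del_vert s\<^esub> x" "b \<rightarrow>\<^sup>*\<^bsub>del_vert s\<^esub> x"
    using assms ne adj_in_verts by (blast intro: reaches_root_avoiding)+
  then have "a \<rightarrow>\<^sup>*\<^bsub>del_vert s\<^esub> b"
    using symmetric_reachable[OF sym] D.reachable_trans by blast
  then show ?thesis using neighbours_separated assms(2,3) by blast
qed

text \<open>
  A neighbour on the same level as \<open>s\<close> would have to coincide with the parent of \<open>s\<close>.
\<close>
lemma hop_dist_adj_neq:
  assumes "x \<in> verts G" "s \<rightarrow> a"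
  shows "d x a \<noteq> d x s"
proof
  assume eq: "d x a = d x s"
  have v: "s \<in> verts G" "a \<in> verts G" using assms(2) adj_in_verts by auto
  show False
  proof (cases "d x s")
    case 0
    then show False
      using eq v assms hop_dist_eq_0_iff adj_not_same by metis
  next
    case (Suc k)
    then obtain b where "s \<rightarrow> b" "d x b = k" using closer_neighbour[OF assms(1) v(1)] by metis
    then show False using at_most_one_parent[OF assms(1,2)] eq Suc by force
  qed
qed

lemma hop_dist_adj_cases:
  assumes "x \<in> verts G" "s \<rightarrow> a"
  shows "d x a = Suc (d x s) \<or> d x s = Suc (d x a)"
  using hop_dist_adj_le[OF assms] hop_dist_adj_le[OF assms(1) adj_sym[OF assms(2)]]
    hop_dist_adj_neq[OF assms] by linarith

text \<open>
  At most one of \<open>a\<close>, \<open>b\<close> is the parent of \<open>s\<close> in the tree rooted at \<open>x\<close>; the other one is a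
  child.
\<close>
lemma Suc_hop_dist_eq_max:
  assumes "x \<in> verts G" "s \<rightarrow> a" "s \<rightarrow> b" "a \<noteq> b"
  shows "Suc (d x s) = max (d x a) (d x b)"
  using hop_dist_adj_cases[OF assms(1,2)] hop_dist_adj_cases[OF assms(1,3)]
    at_most_one_parent[OF assms(1-3)] assms(4) by auto

section \<open>Connected resolving sets of trees\<close>

text \<open>
  The coordinate given by \<open>s\<close> is a function of those given by \<open>a\<close> and \<open>b\<close>.
\<close>
lemma resolving_set_remove_inner:
  assumes S: "resolving_set G S" and "s \<rightarrow> a" "s \<rightarrow> b" "a \<noteq> b" "a \<in> S" "b \<in> S"
  shows "resolving_set G (S - {s})"
  unfolding resolving_set_iff
proof (intro conjI ballI impI)
  show "S - {s} \<subseteq> verts G" using S by (auto simp: resolving_set_iff)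
  fix x y assume xy: "x \<in> verts G" "y \<in> verts G" and eq: "\<forall>z\<in>S - {s}. d z x = d z y"
  have "a \<noteq> s" "b \<noteq> s" using assms(2,3) adj_not_same by auto
  then have "d x a = d y a" "d x b = d y b"
    using eq assms(5,6) by (auto simp: hop_dist_commute[of x] hop_dist_commute[of y])
  then have "d x s = d y s"
    using Suc_hop_dist_eq_max[OF xy(1) assms(2-4)] Suc_hop_dist_eq_max[OF xy(2) assms(2-4)] by simp
  then have "d s x = d s y" by (simp add: hop_dist_commute[of s])
  then have "\<forall>z\<in>S. d z x = d z y" using eq by auto
  then show "x = y" using S xy by (auto simp: resolving_set_iff)
qed

text \<open>
  Removing the edge \<open>ab\<close> splits the tree into the vertices nearer to \<open>a\<close> and those nearer to
  \<open>b\<close>. Within one side the two coordinates determine each other, so distinct vertices have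
  distinct distances to the end of the edge on their side. The labelling \<open>g\<close> puts \<open>a\<close> at 0 and
  \<open>b\<close> at 1 and lets the two sides extend in opposite directions.
\<close>
lemma path_if_edge_resolves:
  assumes S: "resolving_set G {a, b}" and ab: "a \<rightarrow> b"
  shows "digraph_iso G (with_proj (path_graph (card (verts G))))"
proof -
  define g :: "'a \<Rightarrow> int" where
    "g x = (if d a x < d b x then - int (d a x) else int (d b x) + 1)" for x
  have v: "a \<in> verts G" "b \<in> verts G" using ab adj_in_verts by auto
  have side: "d b x = Suc (d a x) \<or> d a x = Suc (d b x)" if "x \<in> verts G" for x
    using hop_dist_adj_cases[OF that ab] by (simp add: hop_dist_commute[of x])
  have "inj_on g (verts G)"
  proof (rule inj_onI)
    fix x y assume xy: "x \<in> verts G" "y \<in> verts G" "g x = g y"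
    then have "d a x = d a y \<and> d b x = d b y"
      using side[OF xy(1)] side[OF xy(2)] by (auto simp: g_def split: if_splits)
    then show "x = y" using S xy by (auto simp: resolving_set_iff)
  qed
  moreover have "g y \<le> g x + 1" if xy: "x \<rightarrow> y" for x y
  proof (cases "d a x < d b x \<and> \<not> d a y < d b y")
    case True
    have vxy: "x \<in> verts G" "y \<in> verts G" using xy adj_in_verts by auto
    have eqs: "d b x = Suc (d a x)" "d a y = Suc (d b y)"
      using True side vxy by force+
    have q: "d b y = d a x"
      using hop_dist_adj_cases[OF v(1) xy] hop_dist_adj_cases[OF v(2) xy] eqs by linarith
    \<comment> \<open>An edge between the sides can only be \<open>ab\<close>: otherwise the vertex \<open>w\<close> after \<open>y\<close> on the
      way to \<open>b\<close> would, like \<open>x\<close>, be a parent of \<open>y\<close> in the tree rooted at \<open>a\<close>, although \<open>w\<close>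
      lies closer to \<open>b\<close> than \<open>x\<close> does.\<close>
    have "d b y = 0"
    proof (rule ccontr)
      assume "d b y \<noteq> 0"
      then obtain k where k: "d b y = Suc k" using not0_implies_Suc by blast
      then obtain w where w: "y \<rightarrow> w" "d b w = k" using closer_neighbour[OF v(2) vxy(2)] by metis
      then have "w \<in> verts G" using adj_in_verts by auto
      then have "d a w \<le> d a y" using side[of w] w k eqs by linarith
      moreover have "d a x \<le> d a y" using eqs q by linarith
      ultimately have "x = w" using at_most_one_parent[OF v(1) adj_sym[OF xy] w(1)] by blast
      then show False using w(2) eqs(1) q k by simp
    qed
    then show ?thesis using True q by (simp add: g_def)
  next
    case False
    then show ?thesis
      using hop_dist_adj_le[OF v(2) xy] hop_dist_adj_le[OF v(1) adj_sym[OF xy]]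
      by (cases "d a x < d b x"; cases "d a y < d b y"; simp add: g_def)
  qed
  ultimately show ?thesis by (rule path_if_injective_slow_labelling)
qed

lemma path_if_vertex_resolves:
  assumes "resolving_set G {z}"
  shows "digraph_iso G (with_proj (path_graph (card (verts G))))"
proof (rule path_if_injective_slow_labelling)
  show "inj_on (\<lambda>x. int (d z x)) (verts G)"
    using assms by (auto simp: resolving_set_iff inj_on_def)
  show "int (d z v) \<le> int (d z u) + 1" if "u \<rightarrow> v" for u v
    using hop_dist_adj_le[OF _ that, of z] assms by (auto simp: resolving_set_iff)
qed

text \<open>
  Irredundancy leaves every vertex at most one neighbour in \<open>S\<close>, so a connected \<open>S\<close> is a single
  vertex or an edge.
\<close>
lemma path_if_irredundant:
  assumes S: "connected_resolving_set G S"
    and min: "\<And>s. s \<in> S \<Longrightarrow> \<not> resolving_set G (S - {s})"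
  shows "digraph_iso G (with_proj (path_graph (card (verts G))))"
proof -
  have res: "resolving_set G S" and con: "connected (G \<restriction> S)"
    using S by (simp_all add: connected_resolving_set_def)
  then have sub: "S \<subseteq> verts G" by (simp add: resolving_set_iff)
  interpret H: wf_digraph "G \<restriction> S" by (rule wellformed_induce_subgraph)
  have sym: "symmetric (G \<restriction> S)"
    using sym_arcs induced_induce[OF sub] by (rule induced_graph_imp_symmetric)
  have sc: "strongly_connected (G \<restriction> S)"
    using sym con by (rule H.symmetric_connected_imp_strongly_connected)
  have reach: "u \<rightarrow>\<^sup>*\<^bsub>G \<restriction> S\<^esub> v" if "u \<in> S" "v \<in> S" for u v
    using sc that by (simp add: strongly_connected_def)
  have adj_H: "u \<rightarrow>\<^bsub>G \<restriction> S\<^esub> v \<Longrightarrow> u \<rightarrow> v \<and> u \<in> S \<and> v \<in> S" for u v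
    by (auto simp: arcs_ends_conv)
  have one: "u = v" if "s \<rightarrow> u" "s \<rightarrow> v" "s \<in> S" "u \<in> S" "v \<in> S" for s u v
    using resolving_set_remove_inner[OF res that(1,2) _ that(4,5)] min[OF that(3)] by metis
  obtain a where a: "a \<in> S" using sc by (auto simp: strongly_connected_def)
  show ?thesis
  proof (cases "S = {a}")
    case True
    then show ?thesis using res path_if_vertex_resolves by simp
  next
    case False
    then obtain c where c: "c \<in> S" "c \<noteq> a" using a by blast
    from reach[OF a c(1)] obtain b where b: "a \<rightarrow>\<^bsub>G \<restriction> S\<^esub> b"
      using c(2) by (cases rule: pre_digraph.converse_reachable_cases) auto
    then have ab: "a \<rightarrow> b" "b \<in> S" using adj_H by auto
    have "w \<in> {a, b}" if "a \<rightarrow>\<^sup>*\<^bsub>G \<restriction> S\<^esub> w" for w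
      using that
    proof (induction rule: H.reachable_induct)
      case (step x y)
      from adj_H[OF step.hyps(2)] have xy: "x \<rightarrow> y" "y \<in> S" by auto
      from step.IH consider "x = a" | "x = b" by blast
      then show ?case
      proof cases
        case 1
        then show ?thesis using one[of a y b] xy ab a by simp
      next
        case 2
        then show ?thesis using one[of b y a] xy ab a adj_sym[of a b] by simp
      qed
    qed simp
    then have "S = {a, b}" using reach[OF a] a ab(2) by auto
    then show ?thesis using path_if_edge_resolves[of a b] res ab(1) by simp
  qed
qed

end

section \<open>Equality of the two dimensions\<close>

lemma metric_dim_le: "resolving_set G S \<Longrightarrow> metric_dim G \<le> card S"
  unfolding metric_dim_def by (rule Least_le) blast

lemma connected_metric_dim_le: "connected_resolving_set G S \<Longrightarrow> connected_metric_dim G \<le> card S"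
  unfolding connected_metric_dim_def by (rule Least_le) blast

context connected_graph
begin

lemma connected_metric_dim_attained:
  obtains S where "connected_resolving_set G S" "card S = connected_metric_dim G"
proof -
  have "\<exists>S. connected_resolving_set G S \<and> card S = connected_metric_dim G"
    unfolding connected_metric_dim_def
    by (rule LeastI_ex) (use connected_resolving_set_verts in blast)
  then show ?thesis using that by blast
qed

lemma metric_dim_attained:
  obtains S where "resolving_set G S" "card S = metric_dim G"
proof -
  have "\<exists>S. resolving_set G S \<and> card S = metric_dim G"
    unfolding metric_dim_def
    by (rule LeastI_ex)
      (use connected_resolving_set_verts in \<open>auto simp: connected_resolving_set_def\<close>)
  then show ?thesis using that by blast
qed

lemma metric_dim_pos:
  assumes "card (verts G) \<ge> 2"
  shows "metric_dim G > 0"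
proof (rule ccontr)
  assume "\<not> metric_dim G > 0"
  then obtain S where S: "resolving_set G S" "card S = 0" using metric_dim_attained by auto
  then have "S = {}"
    using finite_subset[OF _ finite_verts] by (auto simp: resolving_set_iff)
  then have "\<forall>x\<in>verts G. \<forall>y\<in>verts G. x = y" using S(1) by (simp add: resolving_set_iff)
  then have "card (verts G) \<le> Suc 0" by (auto simp: card_le_Suc0_iff_eq)
  then show False using assms by simp
qed

lemma metric_dim_le_connected_metric_dim: "metric_dim G \<le> connected_metric_dim G"
  using connected_metric_dim_attained metric_dim_le
  by (metis connected_resolving_set_def)

end

theorem proposition7p1:
  fixes T :: "('a, 'b) pre_digraph" and n :: nat
  assumes "undirected_tree T" and "card (verts T) = n" and "n \<ge> 2"
  shows "connected_metric_dim T = metric_dim T \<longleftrightarrow> digraph_iso T (with_proj (path_graph n))"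
proof -
  interpret graph T using assms(1) by (simp add: undirected_tree_def)
  interpret finite_tree T
    by unfold_locales (use assms(1) in \<open>auto simp: undirected_tree_def not_le[symmetric]\<close>)
  show ?thesis
  proof
    assume eq: "connected_metric_dim T = metric_dim T"
    obtain S where S: "connected_resolving_set T S" "card S = connected_metric_dim T"
      by (rule connected_metric_dim_attained)
    have "finite S"
      using S(1) finite_subset[OF _ finite_verts]
      by (auto simp: connected_resolving_set_def resolving_set_iff)
    then have "\<not> resolving_set T (S - {s})" if "s \<in> S" for s
      using metric_dim_le[of T "S - {s}"] card_Diff1_less[of S s] that eq S(2) by auto
    then show "digraph_iso T (with_proj (path_graph n))"
      using path_if_irredundant[OF S(1)] assms(2) by blast
  next
    assume "digraph_iso T (with_proj (path_graph n))"
    then obtain z where "connected_resolving_set T {z}"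
      using path_endpoint_resolves assms(3) by blast
    then have "connected_metric_dim T \<le> 1" using connected_metric_dim_le by fastforce
    then show "connected_metric_dim T = metric_dim T"
      using metric_dim_pos metric_dim_le_connected_metric_dim assms(2,3) by linarith
  qed
qed

end
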